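(* Let $T\in\mathbb{N}^*$, $\rho>0$, $\alpha\in\mathbb{R}$. For $N\in\mathbb{N}^*$ let $W_N$ be an $N\times N$ random matrix with i.i.d. $\mathcal{N}(0,\rho^2/N^{2\alpha})$ entries, and $B_{T,N}$ its generalised matrix of moments of order $T$, with eigenvalues $\lambda_T(B_{T,N})\le\cdots\le\lambda_0(B_{T,N})$ ($\lambda_{\min}=\lambda_T$, $\lambda_{\max}=\lambda_0$). As $N\to\infty$: (1) If $\alpha=1/2$: $\lambda_{\max}(B_{T,N})\simeq N\max(1,\rho^2,\ldots,\rho^{2T})$, $\lambda_{\min}(B_{T,N})\simeq N\min(1,\rho^2,\ldots,\rho^{2T})$, and \[\lim_{N\to\infty}\frac{\lambda_{\max}(B_{T,N})}{\sum_{i=0}^T\lambda_i(B_{T,N})}=\frac{\max(1,\rho^2,\ldots,\rho^{2T})}{\sum_{i=0}^T\rho^{2i}}.\] (2) If $\alpha<1/2$: $\lambda_{\max}(B_{T,N})\simeq\rho^{2T}N^{1+2T(\frac12-\alpha)}$ and $\lambda_{\max}(B_{T,N})/\sum_{i=0}^T\lambda_i(B_{T,N})\to1$. (3) If $\alpha>1/2$: $\lambda_{\max}(B_{T,N})\simeq N$ and $\lambda_{\max}(B_{T,N})/\sum_{i=0}^T\lambda_i(B_{T,N})\to1$.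
   Context: Generalised matrix of moments: for $i\in[N]$, $\beta_{i,0}=1$, $\beta_{i,l}=\sum_{i_1,\ldots,i_l=1}^N W_{ii_1}\cdots W_{i_{l-1}i_l}$ for $l\ge1$, and $B_{T,N}(l_1,l_2)=\mathbb{E}\sum_{i=1}^N\beta_{i,l_1}\beta_{i,l_2}$. $x_N\simeq y_N$ means $x_N/y_N\to1$. *)

theory Defs
  imports "HOL-Probability.Probability" "Jordan_Normal_Form.Char_Poly"
begin

(* Law of W_N: N x N matrix (indexed by {..<N} x {..<N}) with i.i.d. centred Gaussian
   entries of variance rho^2 / N^(2 alpha), i.e. standard deviation rho / N^alpha. *)
definition W_law :: "nat \<Rightarrow> real \<Rightarrow> real \<Rightarrow> (nat \<times> nat \<Rightarrow> real) measure" where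
  "W_law N \<alpha> \<rho> = PiM ({..<N} \<times> {..<N})
      (\<lambda>_. density lborel (normal_density 0 (\<rho> / real N powr \<alpha>)))"

definition path_idx :: "nat \<Rightarrow> (nat \<Rightarrow> nat) \<Rightarrow> nat \<Rightarrow> nat" where
  "path_idx i p k = (if k = 0 then i else p k)"

definition beta :: "nat \<Rightarrow> (nat \<times> nat \<Rightarrow> real) \<Rightarrow> nat \<Rightarrow> nat \<Rightarrow> real" where
  "beta N W i l = (\<Sum>p \<in> PiE {1..l} (\<lambda>_. {..<N}).
       \<Prod>k\<in>{1..l}. W (path_idx i p (k - 1), p k))"

definition B_mat :: "nat \<Rightarrow> nat \<Rightarrow> real \<Rightarrow> real \<Rightarrow> real mat" where
  "B_mat T N \<alpha> \<rho> = mat (T + 1) (T + 1) (\<lambda>(l1, l2).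
      \<integral>W. (\<Sum>i<N. beta N W i l1 * beta N W i l2) \<partial>W_law N \<alpha> \<rho>)"

definition eig_mset :: "real mat \<Rightarrow> real multiset" where
  "eig_mset A = Abs_multiset (\<lambda>x. order x (char_poly A))"

definition eig :: "real mat \<Rightarrow> nat \<Rightarrow> real" where
  "eig A k = rev (sorted_list_of_multiset (eig_mset A)) ! k"

definition asym_eq :: "(nat \<Rightarrow> real) \<Rightarrow> (nat \<Rightarrow> real) \<Rightarrow> bool" where
  "asym_eq x y \<longleftrightarrow> (\<lambda>N. x N / y N) \<longlonglongrightarrow> 1"

end

theory Submission
  imports Defs "HOL-Real_Asymp.Real_Asymp" "Jordan_Normal_Form.Schur_Decomposition"
begin

text \<open>
  Expanding the product, \<open>B(a, b)\<close> is \<open>\<sigma> ^ (a + b)\<close> times a sum over pairs of paths \<open>(p, q)\<close> of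
  lengths \<open>a\<close>, \<open>b\<close> issued from a common root, where a pair contributes only if every directed edge
  is used an even number of times. Such a pair has at most \<open>(a + b) / 2\<close> distinct edges; if it visits
  more than \<open>(a + b) / 2\<close> vertices then its edges form a tree oriented away from the root, which
  forces \<open>p = q\<close> to be a self-avoiding path, contributing exactly 1. All other pairs visit at most
  \<open>(a + b) / 2\<close> vertices and are negligible. Hence \<open>B(a, b) / (N s ^ (a + b))\<close> tends to the Kronecker
  delta, with \<open>s = \<sigma> sqrt N\<close>.

  After division by \<open>N\<close> or \<open>N s ^ (2 T)\<close> the matrix therefore converges to a diagonal matrix. By
  Gershgorin's theorem all eigenvalues approach the limiting diagonal entries; conversely the
  characteristic polynomial at such an entry tends to 0, so each entry is approached by
  some eigenvalue.
\<close>

section \<open>Eigenvalues of real symmetric matrices\<close>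

text \<open>The Hermitian form of \<open>A\<close> at an eigenvector \<open>v\<close> is
  \<open>a\<close> times the squared norm of \<open>v\<close>. It equals its own conjugate because
  \<open>A\<close> is real and symmetric, so \<open>a\<close> is fixed by conjugation.\<close>

lemma symmetric_eigenvalue_real:
  fixes A :: "real mat"
  assumes A: "A \<in> carrier_mat n n"
    and sym: "\<And>i j. i < n \<Longrightarrow> j < n \<Longrightarrow> A $$ (i, j) = A $$ (j, i)"
    and ev: "eigenvalue (map_mat complex_of_real A) a"
  shows "a \<in> \<real>"
proof -
  obtain v where v: "v \<in> carrier_vec n" "v \<noteq> 0\<^sub>v n"
    and eq: "map_mat complex_of_real A *\<^sub>v v = a \<cdot>\<^sub>v v"
    using ev A unfolding eigenvalue_def eigenvector_def by auto
  have row: "(\<Sum>j<n. of_real (A $$ (i, j)) * v $ j) = a * v $ i" if "i < n" for i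
    using arg_cong[OF eq, of "\<lambda>w. w $ i"] that A v(1)
    by (simp add: scalar_prod_def lessThan_atLeast0)
  let ?q = "\<Sum>i<n. cnj (v $ i) * (\<Sum>j<n. of_real (A $$ (i, j)) * v $ j)"
  let ?s = "\<Sum>i<n. v $ i * cnj (v $ i)"
  have q: "?q = a * ?s"
    unfolding sum_distrib_left[of a] by (intro sum.cong refl) (simp add: row)
  \<comment> \<open>Conjugation leaves the real entries alone and exchanges the roles of the two
    indices; symmetry of \<open>A\<close> exchanges them back.\<close>
  have "cnj ?q = (\<Sum>i<n. \<Sum>j<n. of_real (A $$ (i, j)) * v $ i * cnj (v $ j))"
    by (simp add: sum_distrib_left mult_ac)
  also have "\<dots> = (\<Sum>j<n. \<Sum>i<n. of_real (A $$ (i, j)) * v $ i * cnj (v $ j))"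
    by (rule sum.swap)
  also have "\<dots> = ?q"
    using sym by (auto simp: sum_distrib_left mult_ac intro!: sum.cong)
  finally have "cnj a * cnj ?s = a * ?s"
    using q by simp
  moreover have s: "?s = of_real (\<Sum>i<n. (cmod (v $ i))\<^sup>2)"
    by (simp add: complex_norm_square[symmetric])
  moreover have "?s \<noteq> 0"
  proof
    assume "?s = 0"
    hence "(\<Sum>i<n. (cmod (v $ i))\<^sup>2) = 0"
      using s by (metis of_real_eq_0_iff)
    hence "\<forall>i<n. v $ i = 0"
      by (simp add: sum_nonneg_eq_0_iff)
    hence "v = 0\<^sub>v n" using v(1) by auto
    thus False using v(2) by simp
  qed
  ultimately have "cnj a = a" by simp
  thus ?thesis by (simp add: complex_is_Real_iff complex_eq_iff)
qed

text \<open>The factorisation exists over the complex numbers, all its roots are real by the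
  previous lemma, and injectivity of the coefficient embedding carries it back to real
  polynomials.\<close>

lemma symmetric_char_poly_splits:
  fixes A :: "real mat"
  assumes A: "A \<in> carrier_mat n n"
    and sym: "\<And>i j. i < n \<Longrightarrow> j < n \<Longrightarrow> A $$ (i, j) = A $$ (j, i)"
  obtains es where "char_poly A = (\<Prod>e\<leftarrow>es. [:- e, 1:])" "length es = n"
proof -
  let ?A = "map_mat complex_of_real A"
  have Ac: "?A \<in> carrier_mat n n" using A by simp
  obtain as where as: "char_poly ?A = (\<Prod>a\<leftarrow>as. [:- a, 1:])" "length as = n"
    using char_poly_factorized[OF Ac] by blast
  have real: "a \<in> \<real>" if "a \<in> set as" for a
  proof (rule symmetric_eigenvalue_real[OF A sym])
    have "poly (char_poly ?A) a = 0"
      unfolding as(1) using that by (induct as) auto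
    thus "eigenvalue ?A a" using eigenvalue_root_char_poly[OF Ac] by simp
  qed
  define es where "es = map Re as"
  have as_es: "as = map complex_of_real es"
    unfolding es_def using real by (auto simp: map_idI)
  interpret ph: map_poly_inj_idom_hom complex_of_real ..
  have "map_poly complex_of_real (char_poly A) = char_poly ?A"
    using of_real_hom.char_poly_hom[OF A, where 'a = complex] by simp
  also have "\<dots> = map_poly complex_of_real (\<Prod>e\<leftarrow>es. [:- e, 1:])"
    unfolding as(1) as_es
    by (induct es) (simp_all add: of_real_hom.map_poly_pCons_hom ph.hom_mult del: mult_pCons_left mult_pCons_right)
  finally have "char_poly A = (\<Prod>e\<leftarrow>es. [:- e, 1:])"
    by (metis ph.injectivity)
  moreover have "length es = n" using as(2) by (simp add: es_def)
  ultimately show thesis by (rule that)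
qed

text \<open>\<open>Abs_multiset\<close> is informative only for functions of finite support. Here
  the root orders are exactly the multiplicities in \<open>mset es\<close>, so
  \<open>count_inverse\<close> applies.\<close>

lemma eig_mset_eq:
  assumes "char_poly A = (\<Prod>e\<leftarrow>es. [:- e, 1:])"
  shows "eig_mset A = mset es"
proof -
  have "Polynomial.order x (char_poly A) = count (mset es) x" for x
  proof -
    have "Polynomial.order x (\<Prod>e\<leftarrow>es. [:- e, 1:]) = (\<Sum>e\<leftarrow>es. if e = x then 1 else 0)"
      by (subst order_prod_list) (auto simp: o_def order_linear' intro!: arg_cong[of _ _ sum_list])
    also have "\<dots> = count (mset es) x"
      by (induct es) auto
    finally show ?thesis using assms by simp
  qed
  thus ?thesis by (simp add: eig_mset_def count_inverse)
qed

text \<open>The Schur decomposition gives \<open>A = P * B * Q\<close> with \<open>Q * P\<close> the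
  identity and \<open>es\<close> on the diagonal of \<open>B\<close>; reordering the triple sum is
  the cyclicity of the trace.\<close>

lemma trace_eq_sum_eigenvalues:
  fixes A :: "real mat"
  assumes A: "A \<in> carrier_mat n n"
    and cp: "char_poly A = (\<Prod>e\<leftarrow>es. [:- e, 1:])"
  shows "(\<Sum>i<n. A $$ (i, i)) = sum_list es"
proof -
  obtain B P Q where sd: "schur_decomposition A es = (B, P, Q)"
    by (cases "schur_decomposition A es") auto
  have wit: "similar_mat_wit A B P Q" and d: "diag_mat B = es"
    using schur_decomposition[OF A cp sd] by auto
  have c: "B \<in> carrier_mat n n" "P \<in> carrier_mat n n" "Q \<in> carrier_mat n n"
    and QP: "Q * P = 1\<^sub>m n" and AB: "A = P * B * Q"
    using wit A unfolding similar_mat_wit_def Let_def by auto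
  have QPe: "(\<Sum>i<n. Q $$ (k, i) * P $$ (i, j)) = (if k = j then 1 else 0)" if "k < n" "j < n" for k j
    using arg_cong[OF QP, of "\<lambda>M. M $$ (k, j)"] that c
    by (simp add: scalar_prod_def lessThan_atLeast0)
  have "(\<Sum>i<n. A $$ (i, i)) = (\<Sum>i<n. \<Sum>k<n. \<Sum>j<n. P $$ (i, j) * B $$ (j, k) * Q $$ (k, i))"
    unfolding AB using c
    by (simp add: scalar_prod_def lessThan_atLeast0 sum_distrib_right del: assoc_mult_mat)
  also have "\<dots> = (\<Sum>k<n. \<Sum>i<n. \<Sum>j<n. P $$ (i, j) * B $$ (j, k) * Q $$ (k, i))"
    by (rule sum.swap)
  also have "\<dots> = (\<Sum>k<n. \<Sum>j<n. \<Sum>i<n. P $$ (i, j) * B $$ (j, k) * Q $$ (k, i))"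
    by (intro sum.cong refl sum.swap)
  also have "\<dots> = (\<Sum>k<n. \<Sum>j<n. B $$ (j, k) * (\<Sum>i<n. Q $$ (k, i) * P $$ (i, j)))"
    by (simp add: sum_distrib_left mult_ac)
  also have "\<dots> = (\<Sum>k<n. B $$ (k, k))"
    by (simp add: QPe if_distrib[of "\<lambda>x. _ * x"] cong: if_cong)
  also have "\<dots> = sum_list (diag_mat B)"
    using c(1) by (simp add: diag_mat_def sum_list_distinct_conv_sum_set lessThan_atLeast0)
  finally show ?thesis using d by simp
qed

text \<open>The row \<open>l\<close> is one where the eigenvector has its coordinate of largest
  modulus: dividing that row of the eigenvalue equation by this coordinate leaves quotients of
  modulus at most 1.\<close>

lemma gershgorin:
  fixes A :: "real mat"
  assumes A: "A \<in> carrier_mat n n" and ev: "eigenvalue A e"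
  obtains l where "l < n" "\<bar>e - A $$ (l, l)\<bar> \<le> (\<Sum>j\<in>{..<n} - {l}. \<bar>A $$ (l, j)\<bar>)"
proof -
  obtain v where v: "v \<in> carrier_vec n" "v \<noteq> 0\<^sub>v n" and eq: "A *\<^sub>v v = e \<cdot>\<^sub>v v"
    using ev A unfolding eigenvalue_def eigenvector_def by auto
  have row: "(\<Sum>j<n. A $$ (i, j) * v $ j) = e * v $ i" if "i < n" for i
    using arg_cong[OF eq, of "\<lambda>w. w $ i"] that A v(1)
    by (simp add: scalar_prod_def lessThan_atLeast0)
  have ex: "\<exists>i<n. v $ i \<noteq> 0"
  proof (rule ccontr)
    assume "\<not> ?thesis"
    hence "v = 0\<^sub>v n" using v(1) by auto
    thus False using v(2) by simp
  qed
  have "Max ((\<lambda>i. \<bar>v $ i\<bar>) ` {..<n}) \<in> (\<lambda>i. \<bar>v $ i\<bar>) ` {..<n}"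
    using ex by (intro Max_in) auto
  then obtain l where l: "l < n" "\<bar>v $ l\<bar> = Max ((\<lambda>i. \<bar>v $ i\<bar>) ` {..<n})" by force
  have le: "\<bar>v $ i\<bar> \<le> \<bar>v $ l\<bar>" if "i < n" for i
    unfolding l(2) using that by (intro Max_ge) auto
  have pos: "\<bar>v $ l\<bar> > 0"
    using ex le by force
  have "e * v $ l = A $$ (l, l) * v $ l + (\<Sum>j\<in>{..<n} - {l}. A $$ (l, j) * v $ j)"
    using row[OF l(1)] sum.remove[of "{..<n}" l "\<lambda>j. A $$ (l, j) * v $ j"] l(1) by simp
  hence "(e - A $$ (l, l)) * v $ l = (\<Sum>j\<in>{..<n} - {l}. A $$ (l, j) * v $ j)"
    by (simp add: algebra_simps)
  hence "\<bar>e - A $$ (l, l)\<bar> * \<bar>v $ l\<bar> = \<bar>\<Sum>j\<in>{..<n} - {l}. A $$ (l, j) * v $ j\<bar>"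
    by (metis abs_mult)
  also have "\<dots> \<le> (\<Sum>j\<in>{..<n} - {l}. \<bar>A $$ (l, j)\<bar> * \<bar>v $ j\<bar>)"
    using sum_abs[of "\<lambda>j. A $$ (l, j) * v $ j" "{..<n} - {l}"] by (simp add: abs_mult)
  also have "\<dots> \<le> (\<Sum>j\<in>{..<n} - {l}. \<bar>A $$ (l, j)\<bar> * \<bar>v $ l\<bar>)"
    using le by (intro sum_mono mult_left_mono) auto
  also have "\<dots> = (\<Sum>j\<in>{..<n} - {l}. \<bar>A $$ (l, j)\<bar>) * \<bar>v $ l\<bar>"
    by (simp add: sum_distrib_right)
  finally have "\<bar>e - A $$ (l, l)\<bar> \<le> (\<Sum>j\<in>{..<n} - {l}. \<bar>A $$ (l, j)\<bar>)"
    using pos by (simp add: mult_le_cancel_right)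
  thus thesis using l(1) that by blast
qed

text \<open>The interface to \<open>eig\<close> for everything that follows: for a symmetric matrix
  the list behind \<open>eig\<close> really has \<open>n\<close> entries, so the indexing never
  leaves it.\<close>

lemma symmetric_eig_list:
  fixes A :: "real mat"
  assumes A: "A \<in> carrier_mat n n"
    and sym: "\<And>i j. i < n \<Longrightarrow> j < n \<Longrightarrow> A $$ (i, j) = A $$ (j, i)"
  shows "char_poly A = (\<Prod>k<n. [:- eig A k, 1:])"
    and "\<And>k. k < n \<Longrightarrow> eigenvalue A (eig A k)"
    and "(\<Sum>k<n. eig A k) = (\<Sum>i<n. A $$ (i, i))"
    and "\<And>j k. j \<le> k \<Longrightarrow> k < n \<Longrightarrow> eig A k \<le> eig A j"
proof -
  obtain fs where fs: "char_poly A = (\<Prod>e\<leftarrow>fs. [:- e, 1:])" "length fs = n"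
    using symmetric_char_poly_splits[OF A sym] by metis
  define es where "es = rev (sort fs)"
  have eig: "eig A k = es ! k" for k
    unfolding eig_def eig_mset_eq[OF fs(1)] es_def by simp
  have len: "length es = n" using fs(2) by (simp add: es_def)
  have "mset es = mset fs" by (simp add: es_def)
  hence "prod_mset (image_mset (\<lambda>e. [:- e, 1:]) (mset es)) = prod_mset (image_mset (\<lambda>e. [:- e, 1:]) (mset fs))"
    by simp
  hence cp: "char_poly A = (\<Prod>e\<leftarrow>es. [:- e, 1:])"
    using fs(1) by (simp add: prod_mset_prod_list[symmetric])
  have "prod_list (map f es) = (\<Prod>k<n. f (es ! k))" for f :: "real \<Rightarrow> real poly"
    using len by (simp add: prod.list_conv_set_nth lessThan_atLeast0)
  thus prod: "char_poly A = (\<Prod>k<n. [:- eig A k, 1:])"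
    using cp by (simp add: eig)
  show "eigenvalue A (eig A k)" if "k < n" for k
    unfolding eigenvalue_root_char_poly[OF A] prod poly_prod using that by (auto intro!: prod_zero bexI[of _ k])
  show "(\<Sum>k<n. eig A k) = (\<Sum>i<n. A $$ (i, i))"
    unfolding trace_eq_sum_eigenvalues[OF A cp] using len
    by (simp add: eig sum_list_sum_nth lessThan_atLeast0)
  have "sorted (rev es)" by (simp add: es_def)
  thus "eig A k \<le> eig A j" if "j \<le> k" "k < n" for j k
    unfolding eig using that len by (simp add: sorted_rev_nth_mono)
qed


text \<open>Two approximations are combined: \<open>near\<close> puts every scaled eigenvalue close
  to some \<open>d l\<close>, and \<open>hit\<close> puts some scaled eigenvalue close to every
  \<open>d l\<close>. Multiplicities are not tracked, since the extremes are determined without them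
  and the sum is a trace.\<close>

lemma eig_tendsto_diagonal:
  fixes B :: "nat \<Rightarrow> real mat" and c :: "nat \<Rightarrow> real" and d :: "nat \<Rightarrow> real"
  assumes B: "\<And>N. B N \<in> carrier_mat (Suc T) (Suc T)"
    and sym: "\<And>N i j. i \<le> T \<Longrightarrow> j \<le> T \<Longrightarrow> B N $$ (i, j) = B N $$ (j, i)"
    and c: "\<forall>\<^sub>F N in sequentially. c N > 0"
    and lim: "\<And>i j. i \<le> T \<Longrightarrow> j \<le> T \<Longrightarrow>
      (\<lambda>N. B N $$ (i, j) / c N) \<longlonglongrightarrow> (if i = j then d i else 0)"
  shows "(\<lambda>N. eig (B N) 0 / c N) \<longlonglongrightarrow> Max (d ` {..T})"
    and "(\<lambda>N. eig (B N) T / c N) \<longlonglongrightarrow> Min (d ` {..T})"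
    and "(\<lambda>N. (\<Sum>i\<le>T. eig (B N) i) / c N) \<longlonglongrightarrow> (\<Sum>i\<le>T. d i)"
proof -
  have E: "char_poly (B N) = (\<Prod>k<Suc T. [:- eig (B N) k, 1:])"
      "\<And>k. k < Suc T \<Longrightarrow> eigenvalue (B N) (eig (B N) k)"
      "(\<Sum>k<Suc T. eig (B N) k) = (\<Sum>i<Suc T. B N $$ (i, i))"
      "\<And>j k. j \<le> k \<Longrightarrow> k < Suc T \<Longrightarrow> eig (B N) k \<le> eig (B N) j" for N
    using symmetric_eig_list[of "B N" "Suc T"] B sym by (simp_all del: prod.lessThan_Suc sum.lessThan_Suc)
  have near: "\<forall>\<^sub>F N in sequentially. \<forall>k\<le>T. \<exists>l\<le>T. \<bar>eig (B N) k / c N - d l\<bar> < \<epsilon>"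
    if "\<epsilon> > 0" for \<epsilon>
  proof -
    \<comment> \<open>The distance from the centre of the scaled Gershgorin disc to
      \<open>d l\<close>, plus the radius of the disc.\<close>
    define r where "r N l = \<bar>B N $$ (l, l) / c N - d l\<bar> + (\<Sum>j\<in>{..<Suc T} - {l}. \<bar>B N $$ (l, j) / c N\<bar>)" for N l
    have "(\<lambda>N. r N l) \<longlonglongrightarrow> 0" if "l \<le> T" for l
    proof -
      have "(\<lambda>N. r N l) \<longlonglongrightarrow> \<bar>d l - d l\<bar> + (\<Sum>j\<in>{..<Suc T} - {l}. \<bar>0\<bar>)"
      proof (unfold r_def, intro tendsto_add tendsto_rabs tendsto_diff tendsto_sum tendsto_const)
        show "(\<lambda>N. B N $$ (l, l) / c N) \<longlonglongrightarrow> d l"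
          using lim[OF that that] by simp
        show "(\<lambda>N. B N $$ (l, j) / c N) \<longlonglongrightarrow> 0" if "j \<in> {..<Suc T} - {l}" for j
          using lim[OF \<open>l \<le> T\<close>, of j] that by (auto simp: less_Suc_eq_le)
      qed
      thus ?thesis by simp
    qed
    hence "\<forall>\<^sub>F N in sequentially. \<forall>l\<in>{..T}. r N l < \<epsilon>"
      using \<open>\<epsilon> > 0\<close> by (intro eventually_ball_finite) (auto dest!: order_tendstoD(2))
    with c show ?thesis
    proof eventually_elim
      case (elim N)
      show ?case
      proof (intro allI impI)
        fix k assume "k \<le> T"
        then obtain l where l: "l < Suc T"
          "\<bar>eig (B N) k - B N $$ (l, l)\<bar> \<le> (\<Sum>j\<in>{..<Suc T} - {l}. \<bar>B N $$ (l, j)\<bar>)"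
          using gershgorin[OF B E(2)[of k N]] by (metis less_Suc_eq_le)
        have "\<bar>eig (B N) k / c N - B N $$ (l, l) / c N\<bar> = \<bar>eig (B N) k - B N $$ (l, l)\<bar> / c N"
          using elim(1) by (simp add: diff_divide_distrib[symmetric])
        also have "\<dots> \<le> (\<Sum>j\<in>{..<Suc T} - {l}. \<bar>B N $$ (l, j) / c N\<bar>)"
          using divide_right_mono[OF l(2), of "c N"] elim(1) by (simp add: sum_divide_distrib)
        finally have "\<bar>eig (B N) k / c N - d l\<bar> \<le> r N l"
          unfolding r_def by linarith
        moreover have "r N l < \<epsilon>" using elim(2) l(1) by simp
        ultimately show "\<exists>l\<le>T. \<bar>eig (B N) k / c N - d l\<bar> < \<epsilon>"
          using l(1) by (intro exI[of _ l]) auto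
      qed
    qed
  qed
  have hit: "\<forall>\<^sub>F N in sequentially. \<exists>k\<le>T. \<bar>eig (B N) k / c N - d l\<bar> < \<epsilon>"
    if "l \<le> T" "\<epsilon> > 0" for l \<epsilon>
  proof -
    \<comment> \<open>\<open>?b N\<close> is the scalar matrix of \<open>d l\<close> minus the
      scaled matrix, and \<open>?D N\<close> is the Leibniz expansion of its determinant, whose
      limit can be taken entrywise.\<close>
    let ?b = "\<lambda>N i j. (if i = j then d l else 0) - B N $$ (i, j) / c N"
    let ?D = "\<lambda>N. \<Sum>p\<in>{p. p permutes {0..<Suc T}}. signof p * (\<Prod>i = 0..<Suc T. ?b N i (p i))"
    have "?D \<longlonglongrightarrow> (\<Sum>p\<in>{p. p permutes {0..<Suc T}}. signof p *
        (\<Prod>i = 0..<Suc T. (if i = p i then d l else 0) - (if i = p i then d i else 0)))"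
    proof (intro tendsto_sum tendsto_mult tendsto_const tendsto_prod tendsto_diff)
      fix p i assume "p \<in> {p. p permutes {0..<Suc T}}" "i \<in> {0..<Suc T}"
      hence "i \<le> T" "p i \<le> T"
        using permutes_in_image[of p "{0..<Suc T}" i]
        by (simp, metis atLeastLessThan_iff less_Suc_eq_le mem_Collect_eq)
      thus "(\<lambda>N. B N $$ (i, p i) / c N) \<longlonglongrightarrow> (if i = p i then d i else 0)" by (rule lim)
    qed
    \<comment> \<open>Row \<open>l\<close> of the limit matrix vanishes: its factor is
      \<open>d l - d l\<close> if \<open>p\<close> fixes \<open>l\<close>, and \<open>0 - 0\<close>
      otherwise.\<close>
    moreover have "(\<Prod>i = 0..<Suc T. (if i = p i then d l else 0) - (if i = p i then d i else 0)) = 0" for p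
      using \<open>l \<le> T\<close> by (intro prod_zero bexI[of _ l]) auto
    ultimately have D0: "?D \<longlonglongrightarrow> 0" by simp
    \<comment> \<open>The threshold is what \<open>Suc T\<close> factors, each of modulus at least
      \<open>\<epsilon>\<close>, would reach; below it, one factor must be smaller than
      \<open>\<epsilon>\<close>.\<close>
    have "\<forall>\<^sub>F N in sequentially. \<bar>?D N\<bar> < \<epsilon> ^ Suc T"
      using order_tendstoD(2)[OF tendsto_rabs[OF D0], of "\<epsilon> ^ Suc T"] \<open>\<epsilon> > 0\<close> by simp
    with c show ?thesis
    proof eventually_elim
      case (elim N)
      \<comment> \<open>The unscaled characteristic polynomial is evaluated at the rescaled point;
        dividing by \<open>c N ^ Suc T\<close> then scales every factor and every matrix entry at
        once.\<close>
      let ?x = "d l * c N"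
      have "(\<Prod>k<Suc T. d l - eig (B N) k / c N) = (\<Prod>k<Suc T. (?x - eig (B N) k) / c N)"
        using elim(1) by (intro prod.cong) (auto simp: field_simps)
      also have "\<dots> = poly (char_poly (B N)) ?x / c N ^ Suc T"
        unfolding E(1) poly_prod by (simp add: prod_dividef del: prod.lessThan_Suc)
      also have "poly (char_poly (B N)) ?x = det (- char_matrix (B N) ?x)"
        by (rule char_poly_matrix[OF B])
      also have "\<dots> / c N ^ Suc T = ?D N"
      proof -
        have carr: "- char_matrix (B N) ?x \<in> carrier_mat (Suc T) (Suc T)"
          using B[of N] by (simp add: char_matrix_def)
        have "(\<Prod>i = 0..<Suc T. (- char_matrix (B N) ?x) $$ (i, p i)) / c N ^ Suc T =
            (\<Prod>i = 0..<Suc T. ?b N i (p i))" if "p permutes {0..<Suc T}" for p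
        proof -
          have "(\<Prod>i = 0..<Suc T. (- char_matrix (B N) ?x) $$ (i, p i)) / c N ^ Suc T =
              (\<Prod>i = 0..<Suc T. (- char_matrix (B N) ?x) $$ (i, p i) / c N)"
            by (simp only: prod_dividef prod_constant card_atLeastLessThan diff_zero)
          also have "\<dots> = (\<Prod>i = 0..<Suc T. ?b N i (p i))"
          proof (rule prod.cong[OF refl])
            fix i assume "i \<in> {0..<Suc T}"
            hence "i < Suc T" "p i < Suc T" using permutes_in_image[OF that, of i] by auto
            thus "(- char_matrix (B N) ?x) $$ (i, p i) / c N = ?b N i (p i)"
              using B[of N] elim(1) by (auto simp: char_matrix_def diff_divide_distrib)
          qed
          finally show ?thesis .
        qed
        thus ?thesis
          unfolding det_def'[OF carr] sum_divide_distrib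
          by (intro sum.cong refl) (simp only: mem_Collect_eq times_divide_eq_right[symmetric])
      qed
      finally have eq: "\<bar>\<Prod>k<Suc T. d l - eig (B N) k / c N\<bar> < \<epsilon> ^ Suc T"
        using elim(2) by simp
      show ?case
      proof (rule ccontr)
        assume "\<not> ?case"
        hence "\<epsilon> \<le> \<bar>d l - eig (B N) k / c N\<bar>" if "k < Suc T" for k
          using that by (metis abs_minus_commute less_Suc_eq_le not_less)
        hence "(\<Prod>k<Suc T. \<epsilon>) \<le> (\<Prod>k<Suc T. \<bar>d l - eig (B N) k / c N\<bar>)"
          using \<open>\<epsilon> > 0\<close> by (intro prod_mono) auto
        thus False using eq by (simp add: abs_prod del: prod.lessThan_Suc)
      qed
    qed
  qed
  have fin: "finite (d ` {..T})" "d ` {..T} \<noteq> {}" by auto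
  show "(\<lambda>N. eig (B N) 0 / c N) \<longlonglongrightarrow> Max (d ` {..T})"
  proof (rule tendstoI)
    fix \<epsilon> :: real assume "\<epsilon> > 0"
    obtain l where l: "l \<le> T" "Max (d ` {..T}) = d l"
      using Max_in[OF fin] by (metis atMost_iff imageE)
    show "\<forall>\<^sub>F N in sequentially. dist (eig (B N) 0 / c N) (Max (d ` {..T})) < \<epsilon>"
      using c near[OF \<open>\<epsilon> > 0\<close>] hit[OF l(1) \<open>\<epsilon> > 0\<close>]
    proof eventually_elim
      case (elim N)
      \<comment> \<open>\<open>near\<close> bounds the top eigenvalue from above by the largest
        \<open>d\<close> plus \<open>\<epsilon>\<close>; \<open>hit\<close> at the maximising
        \<open>l\<close> bounds some eigenvalue, hence the top one, from below.\<close>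
      obtain l' where l': "l' \<le> T" "\<bar>eig (B N) 0 / c N - d l'\<bar> < \<epsilon>" using elim(2) by blast
      have "d l' \<le> Max (d ` {..T})" using l'(1) by simp
      moreover obtain k where k: "k \<le> T" "\<bar>eig (B N) k / c N - d l\<bar> < \<epsilon>" using elim(3) by blast
      moreover have "eig (B N) k / c N \<le> eig (B N) 0 / c N"
        using E(4)[of 0 k] k(1) elim(1) by (simp add: divide_right_mono)
      ultimately show ?case using l'(2) unfolding l(2) dist_real_def by linarith
    qed
  qed
  show "(\<lambda>N. eig (B N) T / c N) \<longlonglongrightarrow> Min (d ` {..T})"
  proof (rule tendstoI)
    fix \<epsilon> :: real assume "\<epsilon> > 0"
    obtain l where l: "l \<le> T" "Min (d ` {..T}) = d l"
      using Min_in[OF fin] by (metis atMost_iff imageE)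
    show "\<forall>\<^sub>F N in sequentially. dist (eig (B N) T / c N) (Min (d ` {..T})) < \<epsilon>"
      using c near[OF \<open>\<epsilon> > 0\<close>] hit[OF l(1) \<open>\<epsilon> > 0\<close>]
    proof eventually_elim
      case (elim N)
      obtain l' where l': "l' \<le> T" "\<bar>eig (B N) T / c N - d l'\<bar> < \<epsilon>" using elim(2) by blast
      have "Min (d ` {..T}) \<le> d l'" using l'(1) by simp
      moreover obtain k where k: "k \<le> T" "\<bar>eig (B N) k / c N - d l\<bar> < \<epsilon>" using elim(3) by blast
      moreover have "eig (B N) T / c N \<le> eig (B N) k / c N"
        using E(4)[of k T] k(1) elim(1) by (simp add: divide_right_mono)
      ultimately show ?case using l'(2) unfolding l(2) dist_real_def by linarith
    qed
  qed
  have "(\<Sum>i\<le>T. eig (B N) i) / c N = (\<Sum>i\<le>T. B N $$ (i, i) / c N)" for N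
    using E(3)[of N] by (simp add: sum_divide_distrib lessThan_Suc_atMost)
  moreover have "(\<lambda>N. \<Sum>i\<le>T. B N $$ (i, i) / c N) \<longlonglongrightarrow> (\<Sum>i\<le>T. d i)"
    using lim by (intro tendsto_sum) force
  ultimately show "(\<lambda>N. (\<Sum>i\<le>T. eig (B N) i) / c N) \<longlonglongrightarrow> (\<Sum>i\<le>T. d i)"
    by simp
qed

section \<open>Gaussian expectations of path products\<close>

text \<open>The moments of the standard normal law: for \<open>k = 2 * m\<close> the quotient is the
  double factorial of \<open>2 * m - 1\<close>, and odd moments vanish.\<close>

definition gauss_moment :: "nat \<Rightarrow> real" where
  "gauss_moment k = (if even k then fact k / (2 ^ (k div 2) * fact (k div 2)) else 0)"

lemma gauss_moment_simps [simp]: "gauss_moment 0 = 1" "gauss_moment 2 = 1"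
  by (simp_all add: gauss_moment_def)

lemma gauss_moment_nonneg [simp]: "0 \<le> gauss_moment k"
  by (simp add: gauss_moment_def)

lemma gauss_moment_le_fact: "gauss_moment k \<le> fact k"
proof -
  have "1 \<le> 2 ^ (k div 2) * (fact (k div 2) :: real)"
    using mult_mono[of 1 "2 ^ (k div 2) :: real" 1 "fact (k div 2)"] by simp
  thus ?thesis
    by (simp add: gauss_moment_def divide_le_eq)
qed

lemma normal_power_moment:
  assumes "\<sigma> > 0"
  shows "has_bochner_integral (density lborel (normal_density 0 \<sigma>)) (\<lambda>x. x ^ k) (\<sigma> ^ k * gauss_moment k)"
proof -
  have "has_bochner_integral lborel (\<lambda>x. normal_density 0 \<sigma> x * x ^ k) (\<sigma> ^ k * gauss_moment k)"
  proof (cases "even k")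
    case True
    then obtain m where k: "k = 2 * m" by blast
    show ?thesis
      using normal_moment_even[OF assms, of 0 m] assms
      by (simp add: k gauss_moment_def power_divide power_mult mult.commute[of "fact (2 * m)"])
  next
    case False
    then obtain m where k: "k = 2 * m + 1" using oddE by blast
    show ?thesis
      using normal_moment_odd[OF assms, of 0 m] by (simp add: k gauss_moment_def)
  qed
  thus ?thesis
    by (subst has_bochner_integral_density) (simp_all)
qed

section \<open>Pairs of paths from a common root and their edge multiplicities\<close>

definition edge :: "nat \<Rightarrow> (nat \<Rightarrow> nat) \<Rightarrow> nat \<Rightarrow> nat \<times> nat" where
  "edge i p k = (path_idx i p (k - 1), p k)"

text \<open>The exponent of the entry \<open>W e\<close> in the product along both paths. Edges are
  directed, because \<open>W\<close> is not symmetric.\<close>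

definition edge_mult :: "nat \<Rightarrow> nat \<Rightarrow> nat \<times> (nat \<Rightarrow> nat) \<times> (nat \<Rightarrow> nat) \<Rightarrow> nat \<times> nat \<Rightarrow> nat" where
  "edge_mult a b = (\<lambda>(i, p, q) e. card {k \<in> {1..a}. edge i p k = e} + card {k \<in> {1..b}. edge i q k = e})"

definition path_pairs :: "nat \<Rightarrow> nat \<Rightarrow> nat \<Rightarrow> (nat \<times> (nat \<Rightarrow> nat) \<times> (nat \<Rightarrow> nat)) set" where
  "path_pairs N a b = {..<N} \<times> PiE {1..a} (\<lambda>_. {..<N}) \<times> PiE {1..b} (\<lambda>_. {..<N})"

text \<open>The expected product along both paths when the entries have unit variance. Positions
  that are not traversed contribute the zeroth moment 1.\<close>

definition weight :: "nat \<Rightarrow> nat \<Rightarrow> nat \<Rightarrow> nat \<times> (nat \<Rightarrow> nat) \<times> (nat \<Rightarrow> nat) \<Rightarrow> real" where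
  "weight N a b \<tau> = (\<Prod>e\<in>{..<N} \<times> {..<N}. gauss_moment (edge_mult a b \<tau> e))"

definition vertices :: "nat \<Rightarrow> nat \<Rightarrow> nat \<times> (nat \<Rightarrow> nat) \<times> (nat \<Rightarrow> nat) \<Rightarrow> nat set" where
  "vertices a b = (\<lambda>(i, p, q). path_idx i p ` {..a} \<union> path_idx i q ` {..b})"

lemma finite_path_pairs [simp]: "finite (path_pairs N a b)"
  by (auto simp: path_pairs_def intro!: finite_PiE)

lemma edge_in_range:
  assumes "i < N" "p \<in> PiE {1..a} (\<lambda>_. {..<N})" "k \<in> {1..a}"
  shows "edge i p k \<in> {..<N} \<times> {..<N}"
proof -
  have "path_idx i p (k - 1) < N"
    using assms PiE_mem[OF assms(2), of "k - 1"] by (cases "k = 1") (force simp: path_idx_def)+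
  thus ?thesis using assms by (auto simp: edge_def PiE_iff)
qed

lemma prod_eq_prod_power_card:
  fixes f :: "'b \<Rightarrow> 'c :: comm_monoid_mult"
  assumes "finite S" "finite E" "g ` S \<subseteq> E"
  shows "(\<Prod>k\<in>S. f (g k)) = (\<Prod>e\<in>E. f e ^ card {k \<in> S. g k = e})"
proof -
  have "(\<Prod>k\<in>S. f (g k)) = (\<Prod>e\<in>E. \<Prod>k\<in>{k \<in> S. g k = e}. f (g k))"
    using prod.group[OF assms, of "\<lambda>k. f (g k)"] by simp
  also have "\<dots> = (\<Prod>e\<in>E. f e ^ card {k \<in> S. g k = e})"
    by (intro prod.cong refl) simp
  finally show ?thesis .
qed

lemma sum_card_fibres:
  assumes "finite S" "finite E" "g ` S \<subseteq> E"
  shows "(\<Sum>e\<in>E. card {k \<in> S. g k = e}) = card S"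
  using sum.group[OF assms, of "\<lambda>_. 1 :: nat"] by simp

lemma sum_edge_mult:
  assumes "\<tau> \<in> path_pairs N a b"
  shows "(\<Sum>e\<in>{..<N} \<times> {..<N}. edge_mult a b \<tau> e) = a + b"
proof -
  obtain i p q where \<tau>: "\<tau> = (i, p, q)" by (cases \<tau>)
  have "i < N" "p \<in> PiE {1..a} (\<lambda>_. {..<N})" "q \<in> PiE {1..b} (\<lambda>_. {..<N})"
    using assms by (auto simp: \<tau> path_pairs_def)
  thus ?thesis
    using sum_card_fibres[of "{1..a}" "{..<N} \<times> {..<N}" "edge i p"]
      sum_card_fibres[of "{1..b}" "{..<N} \<times> {..<N}" "edge i q"]
    by (simp add: \<tau> edge_mult_def sum.distrib image_subset_iff edge_in_range)
qed

text \<open>A product of two factorials divides the factorial of the sum, and induction extends the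
  resulting bound to \<open>E\<close>.\<close>

lemma prod_fact_le_fact_sum:
  "finite E \<Longrightarrow> (\<Prod>e\<in>E. fact (m e) :: real) \<le> fact (\<Sum>e\<in>E. m e)"
proof (induct E rule: finite_induct)
  case (insert e E)
  have "fact (m e) * (\<Prod>e\<in>E. fact (m e) :: real) \<le> fact (m e) * fact (\<Sum>e\<in>E. m e)"
    using insert by (intro mult_left_mono) auto
  also have "\<dots> = of_nat (fact (m e) * fact (\<Sum>e\<in>E. m e))"
    by simp
  also have "\<dots> \<le> of_nat (fact (m e + (\<Sum>e\<in>E. m e)))"
    by (intro of_nat_mono dvd_imp_le fact_fact_dvd_fact) simp
  finally show ?case using insert by simp
qed simp

text \<open>Although the product runs over \<open>N * N\<close> positions, the multiplicities sum to
  \<open>a + b\<close>, so the moments combine into a bound free of \<open>N\<close>.\<close>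

lemma weight_bounds:
  assumes "\<tau> \<in> path_pairs N a b"
  shows "0 \<le> weight N a b \<tau>" "weight N a b \<tau> \<le> fact (a + b)"
proof -
  show "0 \<le> weight N a b \<tau>" by (simp add: weight_def prod_nonneg)
  have "weight N a b \<tau> \<le> (\<Prod>e\<in>{..<N} \<times> {..<N}. fact (edge_mult a b \<tau> e))"
    unfolding weight_def by (intro prod_mono conjI gauss_moment_le_fact gauss_moment_nonneg)
  also have "\<dots> \<le> fact (\<Sum>e\<in>{..<N} \<times> {..<N}. edge_mult a b \<tau> e)"
    by (rule prod_fact_le_fact_sum) simp
  finally show "weight N a b \<tau> \<le> fact (a + b)"
    by (simp only: sum_edge_mult[OF assms])
qed

text \<open>Grouping the factors by directed edge gives powers of distinct entries; independence
  then splits the expectation into one-dimensional Gaussian moments.\<close>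

lemma expectation_path_product:
  assumes \<tau>: "(i, p, q) \<in> path_pairs N a b" and \<sigma>: "\<rho> / real N powr \<alpha> > 0"
  shows "has_bochner_integral (W_law N \<alpha> \<rho>)
    (\<lambda>W. (\<Prod>k\<in>{1..a}. W (edge i p k)) * (\<Prod>k\<in>{1..b}. W (edge i q k)))
    ((\<rho> / real N powr \<alpha>) ^ (a + b) * weight N a b (i, p, q))"
proof -
  let ?\<sigma> = "\<rho> / real N powr \<alpha>"
  let ?M = "\<lambda>_ :: nat \<times> nat. density lborel (normal_density 0 ?\<sigma>)"
  let ?I = "{..<N} \<times> {..<N}"
  let ?m = "edge_mult a b (i, p, q)"
  have ps: "prob_space (density lborel (normal_density 0 ?\<sigma>))"
    by (rule prob_space_normal_density[OF \<sigma>])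
  interpret product_sigma_finite ?M
    by (intro product_sigma_finite.intro prob_space_imp_sigma_finite ps)
  have r: "i < N" "p \<in> PiE {1..a} (\<lambda>_. {..<N})" "q \<in> PiE {1..b} (\<lambda>_. {..<N})"
    using \<tau> by (auto simp: path_pairs_def)
  have eq: "(\<Prod>k\<in>{1..a}. W (edge i p k)) * (\<Prod>k\<in>{1..b}. W (edge i q k)) = (\<Prod>e\<in>?I. W e ^ ?m e)"
    for W :: "nat \<times> nat \<Rightarrow> real"
    using prod_eq_prod_power_card[of "{1..a}" ?I "edge i p" W]
      prod_eq_prod_power_card[of "{1..b}" ?I "edge i q" W] edge_in_range[OF r(1,2)] edge_in_range[OF r(1,3)]
    by (simp add: edge_mult_def power_add prod.distrib image_subset_iff)
  note mom = normal_power_moment[OF \<sigma>]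
  have int: "integrable (?M e) (\<lambda>x. x ^ ?m e)" for e
    using mom by (rule integrable.intros)
  have "(\<integral>W. (\<Prod>e\<in>?I. W e ^ ?m e) \<partial>W_law N \<alpha> \<rho>) = (\<Prod>e\<in>?I. \<integral>x. x ^ ?m e \<partial>?M e)"
    unfolding W_law_def by (rule product_integral_prod) (simp_all add: int)
  also have "\<dots> = (\<Prod>e\<in>?I. ?\<sigma> ^ ?m e * gauss_moment (?m e))"
    by (intro prod.cong refl has_bochner_integral_integral_eq mom)
  also have "\<dots> = ?\<sigma> ^ (\<Sum>e\<in>?I. ?m e) * weight N a b (i, p, q)"
    by (simp add: prod.distrib weight_def power_sum)
  also have "(\<Sum>e\<in>?I. ?m e) = a + b"
    by (rule sum_edge_mult[OF \<tau>])
  finally show ?thesis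
    unfolding eq has_bochner_integral_iff W_law_def
    by (auto intro!: product_integrable_prod int)
qed

text \<open>All dependence on \<open>\<rho>\<close> and \<open>\<alpha>\<close> is collected in the
  power of the standard deviation; the remaining sum is purely combinatorial.\<close>

lemma B_mat_entry:
  assumes "a \<le> T" "b \<le> T" and \<sigma>: "\<rho> / real N powr \<alpha> > 0"
  shows "B_mat T N \<alpha> \<rho> $$ (a, b) =
    (\<rho> / real N powr \<alpha>) ^ (a + b) * (\<Sum>\<tau>\<in>path_pairs N a b. weight N a b \<tau>)"
proof -
  let ?P = "\<lambda>l. PiE {1..l} (\<lambda>_. {..<N})"
  let ?f = "\<lambda>W \<tau>. case \<tau> of (i, p, q) \<Rightarrow> (\<Prod>k\<in>{1..a}. W (edge i p k)) * (\<Prod>k\<in>{1..b}. W (edge i q k) :: real)"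
  have eq: "(\<Sum>i<N. beta N W i a * beta N W i b) = (\<Sum>\<tau>\<in>path_pairs N a b. ?f W \<tau>)" for W
  proof -
    have "(\<Sum>i<N. beta N W i a * beta N W i b) = (\<Sum>i<N. \<Sum>p\<in>?P a. \<Sum>q\<in>?P b. ?f W (i, p, q))"
      by (simp add: beta_def edge_def sum_product)
    thus ?thesis
      by (simp add: sum.cartesian_product path_pairs_def)
  qed
  have "has_bochner_integral (W_law N \<alpha> \<rho>) (\<lambda>W. \<Sum>\<tau>\<in>path_pairs N a b. ?f W \<tau>)
      (\<Sum>\<tau>\<in>path_pairs N a b. (\<rho> / real N powr \<alpha>) ^ (a + b) * weight N a b \<tau>)"
    using expectation_path_product[OF _ \<sigma>]
    by (intro has_bochner_integral_sum) (auto simp: split_beta)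
  thus ?thesis using assms(1,2)
    by (simp add: B_mat_def eq has_bochner_integral_integral_eq sum_distrib_left)
qed

text \<open>Such a pair is the image of a pattern on \<open>m\<close> labels under a map from labels
  to vertices. There are \<open>m ^ (1 + a + b)\<close> patterns and \<open>N ^ m\<close> maps;
  counting the same pair several times does no harm to an upper bound.\<close>

lemma card_few_vertices:
  "card {\<tau> \<in> path_pairs N a b. card (vertices a b \<tau>) \<le> m} \<le> m ^ (1 + a + b) * N ^ m"
proof -
  let ?P = "\<lambda>l. PiE {1..l} (\<lambda>_. {..<m})"
  let ?D = "PiE {..<m} (\<lambda>_. {..<N}) \<times> {..<m} \<times> ?P a \<times> ?P b"
  let ?F = "\<lambda>(g :: nat \<Rightarrow> nat, i :: nat, p, q). (g i, restrict (g \<circ> p) {1..a}, restrict (g \<circ> q) {1..b})"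
  have "{\<tau> \<in> path_pairs N a b. card (vertices a b \<tau>) \<le> m} \<subseteq> ?F ` ?D"
  proof
    fix \<tau> assume "\<tau> \<in> {\<tau> \<in> path_pairs N a b. card (vertices a b \<tau>) \<le> m}"
    then obtain i p q where \<tau>: "\<tau> = (i, p, q)" and i: "i < N"
      and p: "p \<in> PiE {1..a} (\<lambda>_. {..<N})" and q: "q \<in> PiE {1..b} (\<lambda>_. {..<N})"
      and card: "card (vertices a b \<tau>) \<le> m"
      by (auto simp: path_pairs_def)
    let ?V = "vertices a b \<tau>"
    have V: "finite ?V" "i \<in> ?V" "\<And>k. k \<in> {1..a} \<Longrightarrow> p k \<in> ?V" "\<And>k. k \<in> {1..b} \<Longrightarrow> q k \<in> ?V"
      by (force simp: \<tau> vertices_def path_idx_def)+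
    have VN: "?V \<subseteq> {..<N}"
      using i PiE_mem[OF p] PiE_mem[OF q] by (auto simp: \<tau> vertices_def path_idx_def)
    obtain h where h: "bij_betw h ?V {0..<card ?V}"
      using ex_bij_betw_finite_nat[OF V(1)] by blast
    have hm: "h v < m" if "v \<in> ?V" for v
      using bij_betw_apply[OF h that] card by simp
    \<comment> \<open>\<open>h\<close> numbers the visited vertices and \<open>g\<close> inverts it;
      surplus labels are sent to the root \<open>i\<close>, so that \<open>g\<close> still takes
      values below \<open>N\<close>.\<close>
    define g where "g = restrict (\<lambda>k. if k < card ?V then inv_into ?V h k else i) {..<m}"
    have gh: "g (h v) = v" if "v \<in> ?V" for v
      using that h hm[OF that] bij_betw_apply[OF h that]
      by (simp add: g_def bij_betw_def inv_into_f_f)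
    have g: "g \<in> PiE {..<m} (\<lambda>_. {..<N})"
    proof (rule PiE_I)
      fix k assume "k \<in> {..<m}"
      moreover have "inv_into ?V h k \<in> ?V" if "k < card ?V"
        using h that by (intro inv_into_into) (simp add: bij_betw_def)
      ultimately show "g k \<in> {..<N}" using VN i by (auto simp: g_def)
    qed (simp add: g_def)
    define p' q' where "p' = restrict (h \<circ> p) {1..a}" and "q' = restrict (h \<circ> q) {1..b}"
    have "restrict (g \<circ> p') {1..a} = p"
    proof
      show "restrict (g \<circ> p') {1..a} k = p k" for k
        using V(3)[of k] gh[of "p k"] PiE_arb[OF p, of k] by (simp add: p'_def)
    qed
    moreover have "restrict (g \<circ> q') {1..b} = q"
    proof
      show "restrict (g \<circ> q') {1..b} k = q k" for k
        using V(4)[of k] gh[of "q k"] PiE_arb[OF q, of k] by (simp add: q'_def)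
    qed
    ultimately have "\<tau> = ?F (g, h i, p', q')"
      unfolding \<tau> by (simp only: prod.case gh[OF V(2)])
    moreover have "p' \<in> ?P a" "q' \<in> ?P b"
      unfolding p'_def q'_def using V(3,4) hm by (simp_all add: restrict_PiE_iff)
    hence "(g, h i, p', q') \<in> ?D"
      using g hm[OF V(2)] by (intro SigmaI) simp_all
    ultimately show "\<tau> \<in> ?F ` ?D" by (rule image_eqI)
  qed
  moreover have fin: "finite ?D" by (auto intro!: finite_PiE)
  ultimately have "card {\<tau> \<in> path_pairs N a b. card (vertices a b \<tau>) \<le> m} \<le> card ?D"
    by (meson card_image_le card_mono finite_imageI le_trans)
  also have "\<dots> = m ^ (1 + a + b) * N ^ m"
    by (simp add: card_cartesian_product card_PiE power_add)
  finally show ?thesis .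
qed

section \<open>Asymptotics of the moment matrix\<close>

text \<open>With more vertices than edges, each vertex can be traced back to the root in only one
  way, which fixes the time at which any path reaches it. So no path revisits a vertex, and parity
  then forces each step of one path to be matched by the same step of the other.\<close>

lemma many_vertices_imp_equal_paths:
  assumes \<tau>: "(i, p, q) \<in> path_pairs N a b"
    and even: "\<And>e. e \<in> {..<N} \<times> {..<N} \<Longrightarrow> even (edge_mult a b (i, p, q) e)"
    and many: "(a + b) div 2 < card (vertices a b (i, p, q))"
  shows "a = b" "p = q" "inj_on (path_idx i p) {..a}"
proof -
  define E where "E = edge i p ` {1..a} \<union> edge i q ` {1..b}"
  let ?V = "vertices a b (i, p, q)" and ?m = "edge_mult a b (i, p, q)"
  have r: "i < N" "p \<in> PiE {1..a} (\<lambda>_. {..<N})" "q \<in> PiE {1..b} (\<lambda>_. {..<N})"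
    using \<tau> by (auto simp: path_pairs_def)
  have E: "finite E" "E \<subseteq> {..<N} \<times> {..<N}"
    using edge_in_range[OF r(1,2)] edge_in_range[OF r(1,3)] unfolding E_def by blast+
  have two: "2 \<le> ?m e" if "e \<in> E" for e
  proof -
    have "?m e \<noteq> 0" using that by (auto simp: E_def edge_mult_def)
    moreover have "even (?m e)" using even that E(2) by blast
    ultimately show ?thesis by (cases "?m e = 1") auto
  qed
  \<comment> \<open>Each used edge is used at least twice and the multiplicities sum to
    \<open>a + b\<close>, so \<open>card E\<close> is at most \<open>(a + b) div 2\<close>.\<close>
  have "2 * card E = (\<Sum>e\<in>E. 2)" by simp
  also have "\<dots> \<le> (\<Sum>e\<in>E. ?m e)" using two by (rule sum_mono)
  also have "\<dots> \<le> (\<Sum>e\<in>{..<N} \<times> {..<N}. ?m e)" using E(2) by (intro sum_mono2) auto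
  finally have "card E < card ?V"
    using many sum_edge_mult[OF \<tau>] by linarith
  have "path_idx i r ` {..c} \<subseteq> insert i (snd ` edge i r ` {1..c})" for r c
    by (force simp: path_idx_def edge_def)
  from this[of p a] this[of q b] have V: "?V \<subseteq> insert i (snd ` E)"
    unfolding vertices_def E_def image_Un by blast
  \<comment> \<open>Every vertex except the root is the head of an edge, and there are fewer edges than
    vertices: so no edge enters the root and every other vertex is entered by exactly one edge.\<close>
  have root: "i \<notin> snd ` E"
  proof
    assume "i \<in> snd ` E"
    hence "card ?V \<le> card (snd ` E)" using V E(1) by (intro card_mono) auto
    also have "\<dots> \<le> card E" using E(1) by (rule card_image_le)
    finally show False using \<open>card E < card ?V\<close> by simp
  qed
  have inj: "inj_on snd E"
  proof (rule eq_card_imp_inj_on[OF E(1)])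
    have "card ?V \<le> card (insert i (snd ` E))" using V E(1) by (intro card_mono) auto
    also have "\<dots> = Suc (card (snd ` E))" using root E(1) by simp
    finally show "card (snd ` E) = card E"
      using \<open>card E < card ?V\<close> card_image_le[OF E(1), of snd] by simp
  qed
  \<comment> \<open>Induction backwards along the unique incoming edges until the root, which no
    edge enters. The two paths may coincide, which gives injectivity, or be \<open>p\<close> and
    \<open>q\<close>, which synchronises them.\<close>
  have same_time: "j = k"
    if "path_idx i r j = path_idx i s k" "j \<le> c" "k \<le> d" "edge i r ` {1..c} \<subseteq> E" "edge i s ` {1..d} \<subseteq> E"
    for r s c d j k
    using that(1-3)
  proof (induct j arbitrary: k)
    case 0
    show ?case
    proof (cases k)
      case (Suc k')
      hence "edge i s k \<in> E" using 0 that(5) by auto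
      hence "snd (edge i s k) \<in> snd ` E" by (rule imageI)
      thus ?thesis using 0 root Suc by (simp add: edge_def path_idx_def)
    qed simp
  next
    case (Suc j)
    have rE: "edge i r (Suc j) \<in> E" using Suc.prems that(4) by auto
    show ?case
    proof (cases k)
      case 0
      hence "snd (edge i r (Suc j)) = i" using Suc.prems by (simp add: edge_def path_idx_def)
      thus ?thesis using root rE by (metis image_eqI)
    next
      case k: (Suc k')
      have "edge i s k \<in> E" using Suc.prems that(5) k by auto
      moreover have "snd (edge i r (Suc j)) = snd (edge i s k)"
        using Suc.prems k by (simp add: edge_def path_idx_def)
      ultimately have "edge i r (Suc j) = edge i s k" using inj rE by (meson inj_onD)
      hence "path_idx i r j = path_idx i s k'" by (simp add: edge_def k)
      thus ?thesis using Suc.hyps[of k'] Suc.prems k by simp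
    qed
  qed
  have sub: "edge i p ` {1..a} \<subseteq> E" "edge i q ` {1..b} \<subseteq> E" by (auto simp: E_def)
  \<comment> \<open>By \<open>same_time\<close> the path \<open>r\<close> uses its
    \<open>k\<close>-th edge exactly once, so an even total makes \<open>s\<close> use that edge
    too, and at the same time \<open>k\<close>.\<close>
  have follow: "k \<in> {1..d} \<and> s k = r k"
    if "edge i r ` {1..c} \<subseteq> E" "edge i s ` {1..d} \<subseteq> E" "k \<in> {1..c}"
      "even (card {k' \<in> {1..c}. edge i r k' = edge i r k} + card {k' \<in> {1..d}. edge i s k' = edge i r k})"
    for r s c d k
  proof -
    have "{k' \<in> {1..c}. edge i r k' = edge i r k} = {k}"
      using that(3) same_time[OF _ _ _ that(1,1), of _ k] by (auto simp: edge_def path_idx_def)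
    hence "{k' \<in> {1..d}. edge i s k' = edge i r k} \<noteq> {}"
      using that(4) by (metis One_nat_def add_0_right card.empty card_1_singleton_iff odd_one)
    then obtain k' where k': "k' \<in> {1..d}" "s k' = r k" by (auto simp: edge_def)
    hence "k' = k"
      using same_time[OF _ _ _ that(2,1), of k' k] that(3) by (auto simp: path_idx_def)
    thus ?thesis using k' by simp
  qed
  have pq: "k \<in> {1..b} \<and> q k = p k" if "k \<in> {1..a}" for k
    using even[of "edge i p k"] edge_in_range[OF r(1,2) that]
    by (intro follow[OF sub that]) (simp add: edge_mult_def)
  have qp: "k \<in> {1..a} \<and> p k = q k" if "k \<in> {1..b}" for k
    using even[of "edge i q k"] edge_in_range[OF r(1,3) that]
    by (intro follow[OF sub(2,1) that]) (simp add: edge_mult_def add.commute)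
  \<comment> \<open>The last step of either path is also a step of the other, which compares the
    lengths.\<close>
  have "a \<le> b" using pq[of a] by (cases "a = 0") auto
  moreover have "b \<le> a" using qp[of b] by (cases "b = 0") auto
  ultimately show ab: "a = b" by simp
  show "p = q"
    using r(2,3) pq unfolding ab by (intro PiE_ext[of p "{1..b}" _ q]) auto
  show "inj_on (path_idx i p) {..a}"
    using same_time[OF _ _ _ sub(1) sub(1)] by (intro inj_onI) auto
qed

text \<open>Distinct edges have distinct heads, so each edge occurs 0 or 2 times in the doubled
  path, and the Gaussian moments of both orders are 1.\<close>

lemma weight_self_avoiding:
  assumes inj: "inj_on (path_idx i p) {..a}"
  shows "weight N a a (i, p, p) = 1"
  unfolding weight_def
proof (rule prod.neutral, rule ballI)
  fix e
  have "card {k \<in> {1..a}. edge i p k = e} \<le> 1"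
  proof (rule card_le_Suc0_iff_eq[THEN iffD2, folded One_nat_def])
    show "\<forall>k\<in>{k \<in> {1..a}. edge i p k = e}. \<forall>k'\<in>{k \<in> {1..a}. edge i p k = e}. k = k'"
    proof (intro ballI)
      fix k k' assume "k \<in> {k \<in> {1..a}. edge i p k = e}" "k' \<in> {k \<in> {1..a}. edge i p k = e}"
      hence "k \<in> {..a}" "k' \<in> {..a}" "path_idx i p k = path_idx i p k'"
        by (auto simp: edge_def path_idx_def)
      thus "k = k'" using inj_onD[OF inj] by blast
    qed
  qed simp
  hence "edge_mult a a (i, p, p) e \<in> {0, 2}"
    unfolding edge_mult_def prod.case by (auto simp only: le_Suc_eq One_nat_def le_0_eq)
  thus "gauss_moment (edge_mult a a (i, p, p) e) = 1" by auto
qed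

text \<open>The weight agrees with the indicator of diagonal pairs except where few vertices are
  visited, so the error is at most a uniform bound times the number of those exceptions.\<close>

lemma sum_weight_bound:
  "\<bar>(\<Sum>\<tau>\<in>path_pairs N a b. weight N a b \<tau>) - (if a = b then real N ^ Suc a else 0)\<bar>
    \<le> (fact (a + b) + 1) * real (((a + b) div 2) ^ (1 + a + b)) * real N ^ ((a + b) div 2)"
proof -
  let ?m = "(a + b) div 2" and ?\<Omega> = "path_pairs N a b"
  \<comment> \<open>\<open>\<delta>\<close> marks all diagonal pairs, self-avoiding or not, so that
    its total is an exact power of \<open>N\<close>. A doubled path with a repeated vertex visits at
    most \<open>a\<close> vertices and falls into \<open>?S\<close>.\<close>
  define \<delta> :: "nat \<times> (nat \<Rightarrow> nat) \<times> (nat \<Rightarrow> nat) \<Rightarrow> real"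
    where "\<delta> = (\<lambda>(i, p, q). if a = b \<and> p = q then 1 else 0)"
  let ?S = "{\<tau> \<in> ?\<Omega>. card (vertices a b \<tau>) \<le> ?m}"
  have "weight N a b \<tau> = \<delta> \<tau>" if "\<tau> \<in> ?\<Omega>" "\<tau> \<notin> ?S" for \<tau>
  proof -
    obtain i p q where \<tau>: "\<tau> = (i, p, q)" by (cases \<tau>)
    show ?thesis
    proof (cases "\<forall>e\<in>{..<N} \<times> {..<N}. even (edge_mult a b \<tau> e)")
      case True
      have "(i, p, q) \<in> ?\<Omega>" "?m < card (vertices a b (i, p, q))"
        using that by (simp_all add: \<tau>)
      note eq = many_vertices_imp_equal_paths[OF this(1) _ this(2), OF True[unfolded \<tau>, rule_format]]
      have "a = b" "p = q" "inj_on (path_idx i p) {..a}"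
        by (rule eq; assumption)+
      thus ?thesis using weight_self_avoiding[of i p a N] by (simp add: \<tau> \<delta>_def)
    next
      case False
      then obtain e where e: "e \<in> {..<N} \<times> {..<N}" "odd (edge_mult a b \<tau> e)" by blast
      \<comment> \<open>An odd moment kills the weight, and a diagonal pair is excluded because it
        uses every edge an even number of times.\<close>
      hence "weight N a b \<tau> = 0"
        unfolding weight_def by (intro prod_zero bexI[of _ e]) (auto simp: gauss_moment_def)
      moreover have "\<delta> \<tau> = 0"
        using e(2) by (cases "a = b \<and> p = q") (simp_all add: \<tau> \<delta>_def edge_mult_def)
      ultimately show ?thesis by simp
    qed
  qed
  hence "\<forall>\<tau>\<in>?\<Omega> - ?S. weight N a b \<tau> - \<delta> \<tau> = 0" by simp
  hence "\<bar>\<Sum>\<tau>\<in>?\<Omega>. weight N a b \<tau> - \<delta> \<tau>\<bar> = \<bar>\<Sum>\<tau>\<in>?S. weight N a b \<tau> - \<delta> \<tau>\<bar>"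
    by (intro arg_cong[of _ _ abs] sum.mono_neutral_right) simp_all
  also have "\<dots> \<le> (\<Sum>\<tau>\<in>?S. fact (a + b) + 1)"
  proof (rule order_trans[OF sum_abs sum_mono])
    fix \<tau> assume "\<tau> \<in> ?S"
    hence "\<tau> \<in> ?\<Omega>" by simp
    note weight_bounds[OF this]
    moreover have "0 \<le> \<delta> \<tau>" "\<delta> \<tau> \<le> 1" by (auto simp: \<delta>_def split: prod.splits)
    ultimately show "\<bar>weight N a b \<tau> - \<delta> \<tau>\<bar> \<le> fact (a + b) + 1" by linarith
  qed
  also have "\<dots> = (fact (a + b) + 1) * real (card ?S)" by simp
  also have "\<dots> \<le> (fact (a + b) + 1) * real (?m ^ (1 + a + b) * N ^ ?m)"
    by (intro mult_left_mono of_nat_mono card_few_vertices) (simp add: add_nonneg_nonneg)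
  finally have bound: "\<bar>\<Sum>\<tau>\<in>?\<Omega>. weight N a b \<tau> - \<delta> \<tau>\<bar> \<le> (fact (a + b) + 1) * real (?m ^ (1 + a + b)) * real N ^ ?m"
    by (simp only: of_nat_mult of_nat_power mult.assoc)
  have "(\<Sum>\<tau>\<in>?\<Omega>. \<delta> \<tau>) = (if a = b then real N ^ Suc a else 0)"
  proof (cases "a = b")
    case True
    let ?D = "{..<N} \<times> PiE {1..a} (\<lambda>_. {..<N})"
    let ?f = "\<lambda>(i, p). (i, p, p)"
    have "(\<Sum>\<tau>\<in>?\<Omega>. \<delta> \<tau>) = (\<Sum>\<tau>\<in>?f ` ?D. 1)"
    proof (rule sum.mono_neutral_cong_right)
      show "?f ` ?D \<subseteq> ?\<Omega>" using True by (auto simp: path_pairs_def)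
      show "\<forall>\<tau>\<in>?\<Omega> - ?f ` ?D. \<delta> \<tau> = 0"
        by (force simp: path_pairs_def \<delta>_def)
      show "\<delta> \<tau> = 1" if "\<tau> \<in> ?f ` ?D" for \<tau>
        using that True by (auto simp: \<delta>_def)
    qed simp
    also have "\<dots> = real (card (?f ` ?D))" by simp
    also have "card (?f ` ?D) = card ?D"
      by (intro card_image inj_onI) auto
    also have "real (card ?D) = real N ^ Suc a"
      by (simp add: card_cartesian_product card_PiE)
    finally show ?thesis using True by simp
  qed (auto simp: \<delta>_def intro!: sum.neutral)
  thus ?thesis using bound by (simp only: sum_subtractf)
qed

text \<open>The diagonal main term is exactly the normalisation, while the error is of order at most
  \<open>sqrt (real N) ^ (a + b)\<close>; the extra factor \<open>real N\<close> in the denominator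
  makes it vanish.\<close>

lemma sum_weight_tendsto:
  "(\<lambda>N. (\<Sum>\<tau>\<in>path_pairs N a b. weight N a b \<tau>) / (real N * sqrt (real N) ^ (a + b)))
    \<longlonglongrightarrow> (if a = b then 1 else 0)"
proof -
  let ?G = "\<lambda>N. \<Sum>\<tau>\<in>path_pairs N a b. weight N a b \<tau>"
  let ?m = "(a + b) div 2"
  let ?K = "(fact (a + b) + 1) * real (?m ^ (1 + a + b))"
  have "(\<lambda>N. ?G N / (real N * sqrt (real N) ^ (a + b)) - (if a = b then 1 else 0)) \<longlonglongrightarrow> 0"
  proof (rule Lim_null_comparison[OF _ lim_const_over_n[of ?K]])
    show "\<forall>\<^sub>F N in sequentially. norm (?G N / (real N * sqrt (real N) ^ (a + b)) - (if a = b then 1 else 0)) \<le> ?K / real N"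
      using eventually_ge_at_top[of 1]
    proof eventually_elim
      case (elim N)
      let ?d = "real N * sqrt (real N) ^ (a + b)"
      have pos: "?d > 0" using elim by simp
      have "sqrt (real N) ^ (a + a) = real N ^ a"
        by (simp add: power_add flip: power_mult_distrib)
      hence diag: "(if a = b then 1 else 0) = (if a = b then real N ^ Suc a else 0) / ?d"
        using elim by (cases "a = b") simp_all
      have "norm (?G N / ?d - (if a = b then 1 else 0)) = \<bar>?G N - (if a = b then real N ^ Suc a else 0)\<bar> / ?d"
        using pos unfolding diag diff_divide_distrib[symmetric] by simp
      also have "\<dots> \<le> ?K * real N ^ ?m / ?d"
        using pos sum_weight_bound[of N a b] by (intro divide_right_mono) auto
      also have "real N ^ ?m = sqrt (real N) ^ (2 * ?m)"
        by (simp add: power_mult)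
      \<comment> \<open>Rounding in \<open>div\<close> only lowers the exponent, and the base is at
        least 1.\<close>
      also have "?K * sqrt (real N) ^ (2 * ?m) / ?d \<le> ?K * sqrt (real N) ^ (a + b) / ?d"
        using pos elim by (intro divide_right_mono mult_left_mono power_increasing) auto
      also have "\<dots> = ?K / real N" using elim by simp
      finally show ?case .
    qed
  qed
  thus ?thesis by (simp add: LIM_zero_iff)
qed

lemma B_mat_tendsto:
  assumes "\<rho> > 0" "a \<le> T" "b \<le> T"
  shows "(\<lambda>N. B_mat T N \<alpha> \<rho> $$ (a, b) / (real N * (\<rho> / real N powr \<alpha> * sqrt (real N)) ^ (a + b)))
    \<longlonglongrightarrow> (if a = b then 1 else 0)"
proof (rule Lim_transform_eventually[OF sum_weight_tendsto])
  show "\<forall>\<^sub>F N in sequentially.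
      (\<Sum>\<tau>\<in>path_pairs N a b. weight N a b \<tau>) / (real N * sqrt (real N) ^ (a + b)) =
      B_mat T N \<alpha> \<rho> $$ (a, b) / (real N * (\<rho> / real N powr \<alpha> * sqrt (real N)) ^ (a + b))"
    using eventually_gt_at_top[of 0]
  proof eventually_elim
    case (elim N)
    hence \<sigma>: "\<rho> / real N powr \<alpha> > 0" using assms(1) by simp
    thus ?case
      unfolding B_mat_entry[OF assms(2,3) \<sigma>] power_mult_distrib
      by (simp only: mult.left_commute[of "real N"]) (simp only: mult_divide_mult_cancel_left power_not_zero less_irrefl not_False_eq_True)
  qed
qed

section \<open>Extreme eigenvalues of the moment matrix in the three regimes\<close>

lemma B_mat_carrier: "B_mat T N \<alpha> \<rho> \<in> carrier_mat (Suc T) (Suc T)"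
  by (simp add: B_mat_def)

lemma B_mat_symmetric:
  "a \<le> T \<Longrightarrow> b \<le> T \<Longrightarrow> B_mat T N \<alpha> \<rho> $$ (a, b) = B_mat T N \<alpha> \<rho> $$ (b, a)"
  by (simp add: B_mat_def mult.commute)

lemmas B_mat_eig_tendsto = eig_tendsto_diagonal[OF B_mat_carrier B_mat_symmetric]

lemma asym_eq_mult_const:
  assumes "(\<lambda>N. x N / c N) \<longlonglongrightarrow> l" "l \<noteq> 0"
  shows "asym_eq x (\<lambda>N. c N * l)"
  using tendsto_divide[OF assms(1) tendsto_const assms(2)] assms(2) by (simp add: asym_eq_def)

lemma tendsto_ratio_of_scaled:
  fixes c :: "nat \<Rightarrow> real"
  assumes "(\<lambda>N. x N / c N) \<longlonglongrightarrow> l" "(\<lambda>N. y N / c N) \<longlonglongrightarrow> k" "k \<noteq> 0"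
    and c: "\<forall>\<^sub>F N in sequentially. c N > 0"
  shows "(\<lambda>N. x N / y N) \<longlonglongrightarrow> l / k"
proof (rule Lim_transform_eventually[OF tendsto_divide[OF assms(1-3)]])
  show "\<forall>\<^sub>F N in sequentially. (x N / c N) / (y N / c N) = x N / y N"
    using c by eventually_elim simp
qed

lemma Max_indicator:
  fixes t T :: nat
  assumes "t \<le> T"
  shows "Max ((\<lambda>i. if i = t then 1 else 0 :: real) ` {..T}) = 1"
  using assms by (intro Max_eqI finite_imageI) (auto split: if_splits)

text \<open>Serves both regimes away from \<open>\<alpha> = 1/2\<close>, where a single diagonal
  entry dominates: the scaled top eigenvalue and the scaled trace have the same limit 1.\<close>

lemma B_mat_eig_tendsto_rank_one:
  assumes "t \<le> T" and c: "\<forall>\<^sub>F N in sequentially. c N > 0"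
    and lim: "\<And>a b. a \<le> T \<Longrightarrow> b \<le> T \<Longrightarrow>
      (\<lambda>N. B_mat T N \<alpha> \<rho> $$ (a, b) / c N) \<longlonglongrightarrow> (if a = b then if a = t then 1 else 0 else 0)"
  shows "asym_eq (\<lambda>N. eig (B_mat T N \<alpha> \<rho>) 0) c"
    and "(\<lambda>N. eig (B_mat T N \<alpha> \<rho>) 0 / (\<Sum>i\<le>T. eig (B_mat T N \<alpha> \<rho>) i)) \<longlonglongrightarrow> 1"
proof -
  note E = B_mat_eig_tendsto[where c = c and d = "\<lambda>i. if i = t then 1 else 0", OF _ _ c lim]
  have max: "(\<lambda>N. eig (B_mat T N \<alpha> \<rho>) 0 / c N) \<longlonglongrightarrow> 1"
    using E(1) Max_indicator[OF \<open>t \<le> T\<close>] by simp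
  have sum: "(\<lambda>N. (\<Sum>i\<le>T. eig (B_mat T N \<alpha> \<rho>) i) / c N) \<longlonglongrightarrow> 1"
    using E(3) \<open>t \<le> T\<close> by simp
  show "asym_eq (\<lambda>N. eig (B_mat T N \<alpha> \<rho>) 0) c"
    using max by (simp add: asym_eq_def)
  show "(\<lambda>N. eig (B_mat T N \<alpha> \<rho>) 0 / (\<Sum>i\<le>T. eig (B_mat T N \<alpha> \<rho>) i)) \<longlonglongrightarrow> 1"
    using tendsto_ratio_of_scaled[OF max sum _ c] by simp
qed

theorem mainTheorem12:
  fixes T :: nat and \<rho> \<alpha> :: real
  assumes "T \<ge> 1" and "\<rho> > 0"
  shows
   "(\<alpha> = 1/2 \<longrightarrow>
      asym_eq (\<lambda>N. eig (B_mat T N \<alpha> \<rho>) 0)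
              (\<lambda>N. real N * Max ((\<lambda>i. \<rho> ^ (2 * i)) ` {..T})) \<and>
      asym_eq (\<lambda>N. eig (B_mat T N \<alpha> \<rho>) T)
              (\<lambda>N. real N * Min ((\<lambda>i. \<rho> ^ (2 * i)) ` {..T})) \<and>
      (\<lambda>N. eig (B_mat T N \<alpha> \<rho>) 0 / (\<Sum>i\<le>T. eig (B_mat T N \<alpha> \<rho>) i))
        \<longlonglongrightarrow> Max ((\<lambda>i. \<rho> ^ (2 * i)) ` {..T}) / (\<Sum>i\<le>T. \<rho> ^ (2 * i))) \<and>
    (\<alpha> < 1/2 \<longrightarrow>
      asym_eq (\<lambda>N. eig (B_mat T N \<alpha> \<rho>) 0)
              (\<lambda>N. \<rho> ^ (2 * T) * real N powr (1 + 2 * real T * (1/2 - \<alpha>))) \<and>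
      (\<lambda>N. eig (B_mat T N \<alpha> \<rho>) 0 / (\<Sum>i\<le>T. eig (B_mat T N \<alpha> \<rho>) i)) \<longlonglongrightarrow> 1) \<and>
    (\<alpha> > 1/2 \<longrightarrow>
      asym_eq (\<lambda>N. eig (B_mat T N \<alpha> \<rho>) 0) (\<lambda>N. real N) \<and>
      (\<lambda>N. eig (B_mat T N \<alpha> \<rho>) 0 / (\<Sum>i\<le>T. eig (B_mat T N \<alpha> \<rho>) i)) \<longlonglongrightarrow> 1)"
proof -
  note \<rho> = \<open>\<rho> > 0\<close>
  \<comment> \<open>The growth per unit of path length: the diagonal entry \<open>(a, a)\<close> is
    asymptotic to \<open>real N * s N ^ (2 * a)\<close>. The regimes are \<open>s\<close> tending to
    \<open>\<rho>\<close>, to infinity and to 0.\<close>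
  define s where "s N = \<rho> / real N powr \<alpha> * sqrt (real N)" for N :: nat
  have s_eq: "s N = \<rho> * real N powr (1/2 - \<alpha>)" for N
    by (simp add: s_def powr_diff powr_half_sqrt)
  have s_pos: "s N > 0" if "N > 0" for N using that \<rho> by (simp add: s_def)
  have lim: "(\<lambda>N. B_mat T N \<alpha> \<rho> $$ (a, b) / (real N * s N ^ (a + b))) \<longlonglongrightarrow> (if a = b then 1 else 0)"
    if "a \<le> T" "b \<le> T" for a b
    unfolding s_def using B_mat_tendsto[OF \<rho> that] .
  have N_pos: "\<forall>\<^sub>F N in sequentially. real N > 0"
    using eventually_gt_at_top[of "0 :: nat"] by eventually_elim simp
  \<comment> \<open>Dividing by \<open>real N\<close> alone suffices whenever \<open>s\<close>
    converges; it is used with limit \<open>\<rho>\<close> and with limit 0.\<close>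
  have lim_N: "(\<lambda>N. B_mat T N \<alpha> \<rho> $$ (a, b) / real N) \<longlonglongrightarrow> (if a = b then r ^ (2 * a) else 0)"
    if "s \<longlonglongrightarrow> r" "a \<le> T" "b \<le> T" for a b r
  proof -
    have "(\<lambda>N. B_mat T N \<alpha> \<rho> $$ (a, b) / (real N * s N ^ (a + b)) * s N ^ (a + b))
        \<longlonglongrightarrow> (if a = b then 1 else 0) * r ^ (a + b)"
      by (intro tendsto_mult tendsto_power that(1) lim[OF that(2,3)])
    moreover have "\<forall>\<^sub>F N in sequentially.
        B_mat T N \<alpha> \<rho> $$ (a, b) / (real N * s N ^ (a + b)) * s N ^ (a + b) = B_mat T N \<alpha> \<rho> $$ (a, b) / real N"
      using N_pos
    proof eventually_elim
      case (elim N)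
      hence "s N ^ (a + b) \<noteq> 0" using s_pos[of N] by simp
      thus ?case by simp
    qed
    ultimately have "(\<lambda>N. B_mat T N \<alpha> \<rho> $$ (a, b) / real N) \<longlonglongrightarrow> (if a = b then 1 else 0) * r ^ (a + b)"
      by (rule Lim_transform_eventually)
    thus ?thesis by (cases "a = b") (simp_all add: mult_2)
  qed
  show ?thesis
  proof (intro conjI impI)
    assume \<alpha>: "\<alpha> = 1/2"
    \<comment> \<open>Only eventually, since \<open>s 0\<close> is 0.\<close>
    have "\<forall>\<^sub>F N in sequentially. \<rho> = s N"
      using N_pos by eventually_elim (simp add: s_eq \<alpha>)
    hence "s \<longlonglongrightarrow> \<rho>" by (rule Lim_transform_eventually[OF tendsto_const])
    note E = B_mat_eig_tendsto[where c = real and d = "\<lambda>i. \<rho> ^ (2 * i)", OF _ _ N_pos lim_N[OF this]]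
    let ?R = "(\<lambda>i. \<rho> ^ (2 * i)) ` {..T}"
    have fin: "finite ?R" "?R \<noteq> {}" by auto
    have pos: "x > 0" if "x \<in> ?R" for x using that \<rho> by auto
    have "Max ?R \<noteq> 0" "Min ?R \<noteq> 0"
      using pos[OF Max_in[OF fin]] pos[OF Min_in[OF fin]] by (metis less_irrefl)+
    with E(1,2) show "asym_eq (\<lambda>N. eig (B_mat T N \<alpha> \<rho>) 0) (\<lambda>N. real N * Max ?R)"
      "asym_eq (\<lambda>N. eig (B_mat T N \<alpha> \<rho>) T) (\<lambda>N. real N * Min ?R)"
      by (auto intro: asym_eq_mult_const)
    have "(\<Sum>i\<le>T. \<rho> ^ (2 * i)) > 0" using \<rho> by (intro sum_pos) auto
    thus "(\<lambda>N. eig (B_mat T N \<alpha> \<rho>) 0 / (\<Sum>i\<le>T. eig (B_mat T N \<alpha> \<rho>) i))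
        \<longlonglongrightarrow> Max ?R / (\<Sum>i\<le>T. \<rho> ^ (2 * i))"
      using E(1,3) by (intro tendsto_ratio_of_scaled[OF _ _ _ N_pos]) auto
  next
    assume \<alpha>: "\<alpha> < 1/2"
    \<comment> \<open>As \<open>s\<close> tends to infinity, the last diagonal entry dominates and
      sets the scale.\<close>
    let ?c = "\<lambda>N. real N * s N ^ (2 * T)"
    have c_pos: "\<forall>\<^sub>F N in sequentially. ?c N > 0"
      using N_pos by eventually_elim (simp add: s_pos)
    have "filterlim s at_top sequentially"
      unfolding s_eq using \<alpha> \<rho> by real_asymp
    hence inv: "(\<lambda>N. inverse (s N)) \<longlonglongrightarrow> 0" by (rule tendsto_inverse_0_at_top)
    have lim_c: "(\<lambda>N. B_mat T N \<alpha> \<rho> $$ (a, b) / ?c N) \<longlonglongrightarrow> (if a = b then if a = T then 1 else 0 else 0)"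
      if "a \<le> T" "b \<le> T" for a b
    proof -
      \<comment> \<open>The missing powers of \<open>s\<close>. They contribute the limit
        \<open>0 ^ k\<close>, which is 1 exactly when \<open>a\<close> and \<open>b\<close> both
        equal \<open>T\<close>.\<close>
      define k where "k = 2 * T - (a + b)"
      have k: "2 * T = a + b + k" using that by (simp add: k_def)
      have "(\<lambda>N. B_mat T N \<alpha> \<rho> $$ (a, b) / (real N * s N ^ (a + b)) * inverse (s N) ^ k)
          \<longlonglongrightarrow> (if a = b then 1 else 0) * 0 ^ k"
        by (intro tendsto_mult tendsto_power inv lim[OF that])
      moreover have "B_mat T N \<alpha> \<rho> $$ (a, b) / (real N * s N ^ (a + b)) * inverse (s N) ^ k =
          B_mat T N \<alpha> \<rho> $$ (a, b) / ?c N" for N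
        unfolding k power_add[of _ "a + b" k] by (simp add: divide_simps)
      moreover have "(if a = b then 1 else 0) * 0 ^ k = (if a = b then if a = T then 1 else 0 else (0 :: real))"
        using that by (auto simp: k_def)
      ultimately show ?thesis by simp
    qed
    have "s N ^ (2 * T) = \<rho> ^ (2 * T) * real N powr (2 * real T * (1/2 - \<alpha>))" if "N > 0" for N
      using that by (simp add: s_eq power_mult_distrib powr_power mult_ac)
    \<comment> \<open>At \<open>N = 0\<close> both sides are 0, so the equality holds for every
      \<open>N\<close> and can be used to rewrite under the abstraction.\<close>
    hence c_eq: "\<rho> ^ (2 * T) * real N powr (1 + 2 * real T * (1/2 - \<alpha>)) = ?c N" for N
      by (cases "N = 0") (simp_all add: powr_add mult_ac)
    note E = B_mat_eig_tendsto_rank_one[OF order_refl c_pos lim_c]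
    show "asym_eq (\<lambda>N. eig (B_mat T N \<alpha> \<rho>) 0)
        (\<lambda>N. \<rho> ^ (2 * T) * real N powr (1 + 2 * real T * (1/2 - \<alpha>)))"
      unfolding c_eq by (rule E(1))
    show "(\<lambda>N. eig (B_mat T N \<alpha> \<rho>) 0 / (\<Sum>i\<le>T. eig (B_mat T N \<alpha> \<rho>) i)) \<longlonglongrightarrow> 1"
      by (rule E(2))
  next
    assume \<alpha>: "\<alpha> > 1/2"
    have "s \<longlonglongrightarrow> 0"
      unfolding s_eq using \<alpha> \<rho> by real_asymp
    \<comment> \<open>With \<open>s\<close> tending to 0 the diagonal limits are
      \<open>0 ^ (2 * a)\<close>, so only the entry at \<open>a = 0\<close> survives.\<close>
    have lim_0: "(\<lambda>N. B_mat T N \<alpha> \<rho> $$ (a, b) / real N)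
        \<longlonglongrightarrow> (if a = b then if a = 0 then 1 else 0 else 0)" if "a \<le> T" "b \<le> T" for a b
      using lim_N[OF \<open>s \<longlonglongrightarrow> 0\<close> that] by (cases "a = b"; cases "b = 0") (simp_all add: power_0_left)
    note E = B_mat_eig_tendsto_rank_one[OF le0 N_pos lim_0]
    show "asym_eq (\<lambda>N. eig (B_mat T N \<alpha> \<rho>) 0) (\<lambda>N. real N)"
      by (rule E(1))
    show "(\<lambda>N. eig (B_mat T N \<alpha> \<rho>) 0 / (\<Sum>i\<le>T. eig (B_mat T N \<alpha> \<rho>) i)) \<longlonglongrightarrow> 1"
      by (rule E(2))
  qed
qed

end
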